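(* Let $N_0\ge1$ and $j>0$, and let $(M_T)_{0\le T\le N_0}$ be the progressive quenching Markov chain started from $M_0=0$, with $P^{(PQ)}(T,M)=\Pr(M_T=M)$. For all $0\le T\le N_0$ and $M\in\{-T,-T+2,\dots,T\}$, all nearest-neighbour paths from $(0,0)$ to $(T,M)$ have the same probability weight $e^{-\mathcal{E}(T,M)}$, which depends only on $(T,M)$ and is given by $$e^{-\mathcal{E}(T,M)}=\prod_{0\le i<(T-M)/2}\left(\frac{1-m^{(\mathrm{eq})}_{i,-i}}{2}\right)\times\prod_{1\le i\le (T+M)/2}\left(\frac{1+m^{(\mathrm{eq})}_{T-i,M-i}}{2}\right).$$ Moreover $$P^{(PQ)}(T,M)=e^{\mathcal{S}(T,M)-\mathcal{E}(T,M)},\qquad e^{\mathcal{S}(T,M)}=\binom{T}{\frac{M+T}{2}}.$$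
   Context: Model. $N_0$ Ising spins $s_i\in\{-1,+1\}$ sit on the complete graph with energy (inverse temperature absorbed) $H=-\frac{j}{N_0}\sum_{1\le i<k\le N_0}s_is_k$. For $0\le T\le N_0-1$ and $M\in\{-T,-T+2,\dots,T\}$, suppose that $T$ spins are quenched (frozen) with sum $M$; the $N=N_0-T$ unquenched spins $\sigma_1,\dots,\sigma_N$ are then in equilibrium with probability proportional to $$\exp\Big(\tfrac{j}{N_0}\sum_{1\le i<k\le N}\sigma_i\sigma_k+\tfrac{jM}{N_0}\sum_{i=1}^{N}\sigma_i\Big),\qquad \sigma\in\{-1,1\}^N,$$ and $m^{(\mathrm{eq})}_{T,M}$ denotes the expectation of $\sigma_1$ (equivalently, of any one unquenched spin) under this distribution. Progressive quenching (PQ). This is the Markov chain $(M_T)_{0\le T\le N_0}$ with $M_0=0$ and $M_{T+1}=M_T\pm1$, where, given $M_T=M$, the increments $+1$ and $-1$ have probabilities $\frac{1+m^{(\mathrm{eq})}_{T,M}}{2}$ and $\frac{1-m^{(\mathrm{eq})}_{T,M}}{2}$. A path from $(0,0)$ to $(T,M)$ is a sequence $0=x_0,x_1,\dots,x_T=M$ with $|x_{k+1}-x_k|=1$; its weight is the product of the corresponding transition probabilities. Empty products equal $1$. *)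

theory Defs
  imports "HOL-Probability.Probability"
begin

definition spin_configs :: "nat \<Rightarrow> (nat \<Rightarrow> real) set" where
  "spin_configs N = {1..N} \<rightarrow>\<^sub>E {-1, 1}"

definition boltzmann_weight :: "nat \<Rightarrow> real \<Rightarrow> nat \<Rightarrow> int \<Rightarrow> (nat \<Rightarrow> real) \<Rightarrow> real" where
  "boltzmann_weight N0 j T M \<sigma> = (let N = N0 - T in
     exp (j / real N0 * (\<Sum>k=1..N. \<Sum>i=1..<k. \<sigma> i * \<sigma> k)
          + j * real_of_int M / real N0 * (\<Sum>i=1..N. \<sigma> i)))"

definition partition_function :: "nat \<Rightarrow> real \<Rightarrow> nat \<Rightarrow> int \<Rightarrow> real" where
  "partition_function N0 j T M = (\<Sum>\<sigma>\<in>spin_configs (N0 - T). boltzmann_weight N0 j T M \<sigma>)"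

definition equilibrium :: "nat \<Rightarrow> real \<Rightarrow> nat \<Rightarrow> int \<Rightarrow> (nat \<Rightarrow> real) measure" where
  "equilibrium N0 j T M = point_measure (spin_configs (N0 - T))
     (\<lambda>\<sigma>. ennreal (boltzmann_weight N0 j T M \<sigma> / partition_function N0 j T M))"

text \<open>Meaningful for \<open>T < N0\<close> only: for \<open>T \<ge> N0\<close> there is no unquenched spin.\<close>

definition m_eq :: "nat \<Rightarrow> real \<Rightarrow> nat \<Rightarrow> int \<Rightarrow> real" where
  "m_eq N0 j T M = (\<integral>\<sigma>. \<sigma> 1 \<partial>equilibrium N0 j T M)"

text \<open>The set \<open>{-T, -T + 2, \<dots>, T}\<close>.\<close>

definition magnetizations :: "nat \<Rightarrow> int set" where
  "magnetizations T = (\<lambda>k. 2 * int k - int T) ` {0..T}"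

definition pq_transition :: "nat \<Rightarrow> real \<Rightarrow> nat \<Rightarrow> int \<Rightarrow> int \<Rightarrow> real" where
  "pq_transition N0 j T M M' =
     (if M' = M + 1 then (1 + m_eq N0 j T M) / 2
      else if M' = M - 1 then (1 - m_eq N0 j T M) / 2
      else 0)"

text \<open>The process is only constrained (and only required to be measurable) at the times
  \<open>0, \<dots>, N0\<close>. The Markov property is stated by conditioning on histories of positive
  probability.\<close>

definition pq_chain :: "nat \<Rightarrow> real \<Rightarrow> 'a measure \<Rightarrow> (nat \<Rightarrow> 'a \<Rightarrow> int) \<Rightarrow> bool" where
  "pq_chain N0 j P X \<longleftrightarrow>
     prob_space P \<and>
     (\<forall>T\<le>N0. X T \<in> measurable P (count_space UNIV)) \<and>
     (AE \<omega> in P. X 0 \<omega> = 0) \<and>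
     (\<forall>T<N0. \<forall>x y.
        \<P>(\<omega> in P. \<forall>k\<le>T. X k \<omega> = x k) > 0 \<longrightarrow>
        \<P>(\<omega> in P. X (Suc T) \<omega> = y \<bar> \<forall>k\<le>T. X k \<omega> = x k) = pq_transition N0 j T (x T) y)"

text \<open>Only the values at \<open>0, \<dots>, T\<close> of a path matter.\<close>

definition is_path :: "nat \<Rightarrow> int \<Rightarrow> (nat \<Rightarrow> int) \<Rightarrow> bool" where
  "is_path T M x \<longleftrightarrow> x 0 = 0 \<and> x T = M \<and> (\<forall>k<T. \<bar>x (Suc k) - x k\<bar> = 1)"

definition path_weight :: "nat \<Rightarrow> real \<Rightarrow> nat \<Rightarrow> (nat \<Rightarrow> int) \<Rightarrow> real" where
  "path_weight N0 j T x = (\<Prod>k<T. pq_transition N0 j k (x k) (x (Suc k)))"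

end

theory Submission imports Defs begin

text \<open>
  Singling out one unquenched spin shows that the transition from \<open>(T, M)\<close> to \<open>(T + 1, M \<plusminus> 1)\<close>
  has probability \<open>exp (\<plusminus>j M / N0) Z(T + 1, M \<plusminus> 1) / Z(T, M)\<close>, with \<open>Z\<close> the partition function.
  Since \<open>\<plusminus>M = ((M \<plusminus> 1)\<^sup>2 - M\<^sup>2 - 1) / 2\<close>, this is a quotient \<open>W(T + 1, M \<plusminus> 1) / W(T, M)\<close>, so the
  weight of a path telescopes to \<open>W(T, M)\<close>. The paths to \<open>(T, M)\<close> correspond to the sets of
  \<open>(T + M) / 2\<close> up-steps among \<open>T\<close> steps.
\<close>

section \<open>Sums over spin configurations\<close>

text \<open>The argument of \<open>f\<close> is the total of \<open>n\<close> free spins. Recording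
  their number and not their labels lets \<open>{1..N}\<close> and \<open>{2..N}\<close> be treated
  alike once a spin has been split off.\<close>

fun spin_sum :: "nat \<Rightarrow> (real \<Rightarrow> real) \<Rightarrow> real" where
  "spin_sum 0 f = f 0"
| "spin_sum (Suc n) f = spin_sum n (\<lambda>s. f (s + 1)) + spin_sum n (\<lambda>s. f (s - 1))"

lemma spin_sum_cmult: "spin_sum n (\<lambda>s. c * f s) = c * spin_sum n f"
  by (induction n arbitrary: f) (simp_all add: distrib_left)

lemma sum_PiE_insert:
  fixes g :: "('a \<Rightarrow> 'b) \<Rightarrow> 'c::comm_monoid_add"
  assumes "a \<notin> A"
  shows "(\<Sum>\<sigma>\<in>insert a A \<rightarrow>\<^sub>E B. g \<sigma>) = (\<Sum>b\<in>B. \<Sum>\<sigma>\<in>A \<rightarrow>\<^sub>E B. g (\<sigma>(a := b)))"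
proof -
  have "(\<Sum>\<sigma>\<in>insert a A \<rightarrow>\<^sub>E B. g \<sigma>) = (\<Sum>(b, \<sigma>)\<in>B \<times> (A \<rightarrow>\<^sub>E B). g (\<sigma>(a := b)))"
    using inj_combinator[OF assms, of "\<lambda>_. B"]
    by (simp add: PiE_insert_eq sum.reindex case_prod_unfold)
  then show ?thesis
    by (simp add: sum.cartesian_product)
qed

text \<open>The factor \<open>h\<close> marks one spin: the constant 1 leads to the partition
  function, the identity to the numerator of the magnetization. With \<open>rest\<close> as a
  hypothesis, the same splitting also provides the induction step of
  \<open>sum_spins\<close>.\<close>

lemma sum_spins_insert:
  fixes h f :: "real \<Rightarrow> real"
  assumes "finite A" "a \<notin> A"
    and rest: "\<And>f. (\<Sum>\<sigma>\<in>A \<rightarrow>\<^sub>E {-1, 1}. f (sum \<sigma> A)) = spin_sum (card A) f"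
  shows "(\<Sum>\<sigma>\<in>insert a A \<rightarrow>\<^sub>E {-1, 1}. h (\<sigma> a) * f (sum \<sigma> (insert a A))) =
    h 1 * spin_sum (card A) (\<lambda>s. f (s + 1)) + h (-1) * spin_sum (card A) (\<lambda>s. f (s - 1))"
proof -
  have "sum (\<sigma>(a := b)) (insert a A) = sum \<sigma> A + b" for \<sigma> :: "'a \<Rightarrow> real" and b
  proof -
    have "sum (\<sigma>(a := b)) A = sum \<sigma> A"
      using assms(2) by (intro sum.cong) auto
    then show ?thesis using assms(1,2) by simp
  qed
  then have "(\<Sum>\<sigma>\<in>insert a A \<rightarrow>\<^sub>E {-1, 1}. h (\<sigma> a) * f (sum \<sigma> (insert a A))) =
      (\<Sum>b\<in>{-1, 1}. h b * (\<Sum>\<sigma>\<in>A \<rightarrow>\<^sub>E {-1, 1}. f (sum \<sigma> A + b)))"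
    by (simp add: sum_PiE_insert[OF assms(2)] sum_distrib_left del: sum.insert)
  then show ?thesis
    using rest[of "\<lambda>s. f (s + 1)"] rest[of "\<lambda>s. f (s - 1)"] by simp
qed

lemma sum_spins:
  fixes f :: "real \<Rightarrow> real"
  assumes "finite A"
  shows "(\<Sum>\<sigma>\<in>A \<rightarrow>\<^sub>E {-1, 1}. f (sum \<sigma> A)) = spin_sum (card A) f"
  using assms
proof (induction A arbitrary: f rule: finite_induct)
  case empty
  then show ?case by simp
next
  case (insert a A)
  show ?case
    using sum_spins_insert[OF insert(1,2) insert.IH, of "\<lambda>_. 1" f] insert(1,2) by simp
qed

section \<open>Transition probabilities as quotients\<close>

text \<open>In the square of the total spin every pair occurs twice and each of the \<open>N\<close>
  diagonal terms is 1. Hence the energy depends on the total spin only.\<close>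

lemma pair_sum_spins:
  fixes \<sigma> :: "nat \<Rightarrow> real"
  assumes "\<And>i. i \<in> {1..N} \<Longrightarrow> (\<sigma> i)\<^sup>2 = 1"
  shows "(\<Sum>k=1..N. \<Sum>i=1..<k. \<sigma> i * \<sigma> k) = ((\<Sum>i=1..N. \<sigma> i)\<^sup>2 - real N) / 2"
  using assms
proof (induction N)
  case 0
  then show ?case by simp
next
  case (Suc N)
  have "(\<Sum>i=1..<Suc N. \<sigma> i * \<sigma> (Suc N)) = (\<Sum>i=1..N. \<sigma> i) * \<sigma> (Suc N)"
    by (simp add: sum_distrib_right atLeastLessThanSuc_atLeastAtMost)
  moreover have "(\<sigma> (Suc N))\<^sup>2 = 1" using Suc.prems by simp
  moreover have "(\<Sum>k=1..N. \<Sum>i=1..<k. \<sigma> i * \<sigma> k) = ((\<Sum>i=1..N. \<sigma> i)\<^sup>2 - real N) / 2"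
    using Suc by simp
  ultimately show ?case by (simp add: power2_sum field_simps)
qed

definition mean_field_weight :: "nat \<Rightarrow> real \<Rightarrow> nat \<Rightarrow> int \<Rightarrow> real \<Rightarrow> real" where
  "mean_field_weight N0 j T M s =
     exp (j / real N0 * ((s\<^sup>2 - real (N0 - T)) / 2) + j * real_of_int M / real N0 * s)"

lemma boltzmann_weight_eq:
  assumes "\<sigma> \<in> spin_configs (N0 - T)"
  shows "boltzmann_weight N0 j T M \<sigma> = mean_field_weight N0 j T M (sum \<sigma> {1..N0 - T})"
proof -
  have "(\<sigma> i)\<^sup>2 = 1" if "i \<in> {1..N0 - T}" for i
    using assms that unfolding spin_configs_def by (auto dest!: PiE_mem[of _ _ _ i])
  then show ?thesis
    by (simp only: boltzmann_weight_def mean_field_weight_def Let_def pair_sum_spins)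
qed

lemma partition_function_eq:
  "partition_function N0 j T M = spin_sum (N0 - T) (mean_field_weight N0 j T M)"
  using sum_spins[of "{1..N0 - T}" "mean_field_weight N0 j T M"]
  by (simp add: partition_function_def boltzmann_weight_eq) (simp add: spin_configs_def)

lemma finite_spin_configs: "finite (spin_configs N)"
  by (simp add: spin_configs_def finite_PiE)

lemma partition_function_pos: "partition_function N0 j T M > 0"
  unfolding partition_function_def
proof (intro sum_pos finite_spin_configs)
  show "spin_configs (N0 - T) \<noteq> {}" by (simp add: spin_configs_def PiE_eq_empty_iff)
qed (simp add: boltzmann_weight_def Let_def)

lemma m_eq_eq:
  "m_eq N0 j T M = (\<Sum>\<sigma>\<in>spin_configs (N0 - T). \<sigma> 1 * boltzmann_weight N0 j T M \<sigma>)
     / partition_function N0 j T M"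
proof -
  \<comment> \<open>Since \<open>ennreal\<close> sends negative reals to 0, nonnegativity ensures
    that the density is the weight itself.\<close>
  have "boltzmann_weight N0 j T M \<sigma> / partition_function N0 j T M \<ge> 0" for \<sigma>
    using partition_function_pos[of N0 j T M] by (simp add: boltzmann_weight_def Let_def)
  then show ?thesis
    unfolding m_eq_def equilibrium_def
    by (subst lebesgue_integral_point_measure_finite)
      (simp_all add: finite_spin_configs sum_divide_distrib mult.commute)
qed

text \<open>In \<open>(s + 1)^2 = s^2 + 2 s + 1\<close> the cross term raises the field from
  \<open>M\<close> to \<open>M + 1\<close>, the 1 balances the loss of one free spin, and the old
  field acting on the newly frozen spin gives the exponential in front. The case
  \<open>s - 1\<close> is analogous.\<close>

lemma mean_field_weight_shift:
  assumes "T < N0"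
  shows "mean_field_weight N0 j T M (s + 1) =
      exp (j * real_of_int M / real N0) * mean_field_weight N0 j (Suc T) (M + 1) s"
    and "mean_field_weight N0 j T M (s - 1) =
      exp (- (j * real_of_int M / real N0)) * mean_field_weight N0 j (Suc T) (M - 1) s"
proof -
  have "real (N0 - T) = real (N0 - Suc T) + 1" using assms by linarith
  then show "mean_field_weight N0 j T M (s + 1) =
      exp (j * real_of_int M / real N0) * mean_field_weight N0 j (Suc T) (M + 1) s"
    "mean_field_weight N0 j T M (s - 1) =
      exp (- (j * real_of_int M / real N0)) * mean_field_weight N0 j (Suc T) (M - 1) s"
    unfolding mean_field_weight_def exp_add[symmetric] using assms
    by (simp_all add: power2_eq_square field_simps)
qed

text \<open>Once the first spin is fixed, the others behave as the unquenched spins at time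
  \<open>Suc T\<close> in the changed field. This links the partition functions of successive
  times.\<close>

lemma sum_first_spin:
  fixes h :: "real \<Rightarrow> real"
  assumes "T < N0"
  shows "(\<Sum>\<sigma>\<in>spin_configs (N0 - T). h (\<sigma> 1) * boltzmann_weight N0 j T M \<sigma>) =
    h 1 * (exp (j * real_of_int M / real N0) * partition_function N0 j (Suc T) (M + 1)) +
    h (-1) * (exp (- (j * real_of_int M / real N0)) * partition_function N0 j (Suc T) (M - 1))"
proof -
  have ins: "{1..N0 - T} = insert 1 {2..N0 - T}" using assms by auto
  have "(\<Sum>\<sigma>\<in>spin_configs (N0 - T). h (\<sigma> 1) * boltzmann_weight N0 j T M \<sigma>) =
    (\<Sum>\<sigma>\<in>insert 1 {2..N0 - T} \<rightarrow>\<^sub>E {-1, 1}.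
       h (\<sigma> 1) * mean_field_weight N0 j T M (sum \<sigma> (insert 1 {2..N0 - T})))"
    unfolding ins[symmetric] spin_configs_def[symmetric]
    by (intro sum.cong refl) (simp only: boltzmann_weight_eq)
  also have "\<dots> = h 1 * spin_sum (N0 - Suc T) (\<lambda>s. mean_field_weight N0 j T M (s + 1)) +
    h (-1) * spin_sum (N0 - Suc T) (\<lambda>s. mean_field_weight N0 j T M (s - 1))"
    by (subst sum_spins_insert) (simp_all add: sum_spins)
  finally show ?thesis
    using assms by (simp add: mean_field_weight_shift spin_sum_cmult partition_function_eq)
qed

text \<open>By the pair identity the exponential is the Boltzmann factor of \<open>T\<close> frozen
  spins with sum \<open>M\<close> among themselves. So, for \<open>T \<le> N0\<close> and attainable
  \<open>M\<close>, this is the probability of one given configuration of \<open>T\<close> spins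
  with sum \<open>M\<close> when all \<open>N0\<close> spins are in equilibrium.\<close>

definition pq_weight :: "nat \<Rightarrow> real \<Rightarrow> nat \<Rightarrow> int \<Rightarrow> real" where
  "pq_weight N0 j T M = exp (j / real N0 * ((real_of_int M)\<^sup>2 - real T) / 2) *
     partition_function N0 j T M / partition_function N0 j 0 0"

lemma pq_weight_pos: "pq_weight N0 j T M > 0"
  by (simp add: pq_weight_def partition_function_pos)

lemma pq_weight_0: "pq_weight N0 j 0 0 = 1"
  using partition_function_pos[of N0 j 0 0] by (simp add: pq_weight_def)

lemma pq_weight_quotient:
  assumes "N0 \<ge> 1"
  shows "pq_weight N0 j (Suc T) (M + 1) / pq_weight N0 j T M =
      exp (j * real_of_int M / real N0) * partition_function N0 j (Suc T) (M + 1) /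
        partition_function N0 j T M"
    and "pq_weight N0 j (Suc T) (M - 1) / pq_weight N0 j T M =
      exp (- (j * real_of_int M / real N0)) * partition_function N0 j (Suc T) (M - 1) /
        partition_function N0 j T M"
proof -
  have pos: "partition_function N0 j 0 0 \<noteq> 0" "partition_function N0 j T M \<noteq> 0"
    using partition_function_pos by (simp_all add: less_imp_neq[symmetric])
  \<comment> \<open>\<open>(M + 1)^2 - (T + 1)\<close> exceeds \<open>M^2 - T\<close> by
    \<open>2 M\<close>, and \<open>(M - 1)^2 - (T + 1)\<close> exceeds it by \<open>- 2 M\<close>;
    halving gives the field factors.\<close>
  have e: "exp (j / real N0 * ((real_of_int (M + 1))\<^sup>2 - real (Suc T)) / 2) =
      exp (j * real_of_int M / real N0) * exp (j / real N0 * ((real_of_int M)\<^sup>2 - real T) / 2)"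
    "exp (j / real N0 * ((real_of_int (M - 1))\<^sup>2 - real (Suc T)) / 2) =
      exp (- (j * real_of_int M / real N0)) * exp (j / real N0 * ((real_of_int M)\<^sup>2 - real T) / 2)"
    unfolding exp_add[symmetric] using assms by (simp_all add: power2_eq_square field_simps)
  show "pq_weight N0 j (Suc T) (M + 1) / pq_weight N0 j T M =
      exp (j * real_of_int M / real N0) * partition_function N0 j (Suc T) (M + 1) /
        partition_function N0 j T M"
    unfolding pq_weight_def e using pos by simp
  show "pq_weight N0 j (Suc T) (M - 1) / pq_weight N0 j T M =
      exp (- (j * real_of_int M / real N0)) * partition_function N0 j (Suc T) (M - 1) /
        partition_function N0 j T M"
    unfolding pq_weight_def e using pos by simp
qed

text \<open>With \<open>u\<close> and \<open>d\<close> the shares of \<open>Z\<close> in which the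
  first unquenched spin is 1 and -1, the mean is \<open>(u - d) / (u + d)\<close>, so the two
  probabilities are \<open>u / Z\<close> and \<open>d / Z\<close>.\<close>

lemma m_eq_quotient:
  assumes "T < N0"
  shows "(1 + m_eq N0 j T M) / 2 = pq_weight N0 j (Suc T) (M + 1) / pq_weight N0 j T M"
    and "(1 - m_eq N0 j T M) / 2 = pq_weight N0 j (Suc T) (M - 1) / pq_weight N0 j T M"
proof -
  define Z where "Z = partition_function N0 j T M"
  define u where "u = exp (j * real_of_int M / real N0) * partition_function N0 j (Suc T) (M + 1)"
  define d where "d = exp (- (j * real_of_int M / real N0)) * partition_function N0 j (Suc T) (M - 1)"
  have Z: "Z = u + d"
    using sum_first_spin[OF assms, of "\<lambda>_. 1" j M]
    by (simp add: Z_def u_def d_def partition_function_def)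
  have m: "m_eq N0 j T M = (u - d) / Z"
    using sum_first_spin[OF assms, of "\<lambda>s. s" j M] by (simp add: m_eq_eq Z_def u_def d_def)
  have "Z > 0" by (simp add: Z_def partition_function_pos)
  then have "(1 + m_eq N0 j T M) / 2 = u / Z" "(1 - m_eq N0 j T M) / 2 = d / Z"
    using Z m by (simp_all add: field_simps)
  then show "(1 + m_eq N0 j T M) / 2 = pq_weight N0 j (Suc T) (M + 1) / pq_weight N0 j T M"
    "(1 - m_eq N0 j T M) / 2 = pq_weight N0 j (Suc T) (M - 1) / pq_weight N0 j T M"
    using assms by (simp_all add: pq_weight_quotient Z_def u_def d_def)
qed

section \<open>Path weights\<close>

lemma pq_transition_quotient:
  assumes "T < N0" "\<bar>M' - M\<bar> = 1"
  shows "pq_transition N0 j T M M' = pq_weight N0 j (Suc T) M' / pq_weight N0 j T M"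
proof -
  consider "M' = M + 1" | "M' = M - 1" using assms(2) by linarith
  then show ?thesis
    by cases (simp_all add: pq_transition_def m_eq_quotient[OF assms(1)])
qed

lemma path_weight_eq:
  assumes "is_path T M x" "T \<le> N0"
  shows "path_weight N0 j T x = pq_weight N0 j T M"
proof -
  have "path_weight N0 j T x = (\<Prod>k<T. pq_weight N0 j (Suc k) (x (Suc k)) / pq_weight N0 j k (x k))"
    unfolding path_weight_def
    using assms by (intro prod.cong refl pq_transition_quotient) (auto simp: is_path_def)
  also have "\<dots> = pq_weight N0 j T (x T) / pq_weight N0 j 0 (x 0)"
    using pq_weight_pos by (intro prod_lessThan_telescope) (simp add: less_imp_neq[symmetric])
  finally show ?thesis using assms by (simp add: is_path_def pq_weight_0)
qed

text \<open>The right-hand side belongs to the path with \<open>T - k\<close> down-steps followed by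
  \<open>k\<close> up-steps, the latter listed from the end backwards. The two products telescope
  separately and meet at the corner \<open>(T - k, - (T - k))\<close>.\<close>

lemma pq_weight_down_up:
  assumes "T \<le> N0" "k \<le> T" "M = 2 * int k - int T"
  shows "pq_weight N0 j T M =
    (\<Prod>i<T - k. (1 - m_eq N0 j i (- int i)) / 2) *
    (\<Prod>i=1..k. (1 + m_eq N0 j (T - i) (M - int i)) / 2)"
proof -
  let ?W = "pq_weight N0 j"
  have nz: "?W t m \<noteq> 0" for t m using pq_weight_pos[of N0 j t m] by simp
  have "(\<Prod>i<T - k. (1 - m_eq N0 j i (- int i)) / 2) =
      (\<Prod>i<T - k. ?W (Suc i) (- int (Suc i)) / ?W i (- int i))"
  proof (rule prod.cong[OF refl])
    fix i assume "i \<in> {..<T - k}"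
    then have "i < N0" using assms(1) by simp
    moreover have "- int (Suc i) = - int i - 1" by simp
    ultimately show "(1 - m_eq N0 j i (- int i)) / 2 = ?W (Suc i) (- int (Suc i)) / ?W i (- int i)"
      by (simp only: m_eq_quotient(2))
  qed
  also have "\<dots> = ?W (T - k) (- int (T - k))"
    using prod_lessThan_telescope[of "T - k" "\<lambda>i. ?W i (- int i)"] nz by (simp add: pq_weight_0)
  finally have down: "(\<Prod>i<T - k. (1 - m_eq N0 j i (- int i)) / 2) = ?W (T - k) (- int (T - k))" .
  have "(\<Prod>i=1..k. (1 + m_eq N0 j (T - i) (M - int i)) / 2) =
      (\<Prod>i<k. (1 + m_eq N0 j (T - Suc i) (M - int (Suc i))) / 2)"
    by (rule prod.reindex_bij_witness[where i = Suc and j = "\<lambda>i. i - 1"]) auto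
  also have "\<dots> = (\<Prod>i<k. ?W (T - i) (M - int i) / ?W (T - Suc i) (M - int (Suc i)))"
  proof (rule prod.cong[OF refl])
    fix i assume "i \<in> {..<k}"
    then have "i < k" by simp
    then have "T - Suc i < N0" "Suc (T - Suc i) = T - i" using assms(1,2) by linarith+
    then show "(1 + m_eq N0 j (T - Suc i) (M - int (Suc i))) / 2 =
        ?W (T - i) (M - int i) / ?W (T - Suc i) (M - int (Suc i))"
      using m_eq_quotient(1)[of "T - Suc i" N0 j "M - int (Suc i)"] by (simp add: algebra_simps)
  qed
  \<comment> \<open>This telescoping runs backwards in time, from \<open>(T, M)\<close> to the
    corner.\<close>
  also have "\<dots> = ?W T M / ?W (T - k) (M - int k)"
    using prod_lessThan_telescope'[of k "\<lambda>i. ?W (T - i) (M - int i)"] nz by simp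
  also have "M - int k = - int (T - k)" using assms by simp
  finally show ?thesis using down nz by simp
qed

section \<open>Paths as sets of up-steps\<close>

text \<open>The values of a path after time \<open>T\<close> are free, so paths as functions cannot
  be counted directly; the subsets of \<open>{..<T}\<close> can. Here \<open>k\<close> in
  \<open>A\<close> refers to the step from \<open>k\<close> to \<open>Suc k\<close>.\<close>

definition up_set_path :: "nat set \<Rightarrow> nat \<Rightarrow> int" where
  "up_set_path A k = (\<Sum>i<k. if i \<in> A then 1 else -1)"

lemma up_set_path_simps [simp]:
  "up_set_path A 0 = 0"
  "up_set_path A (Suc k) = up_set_path A k + (if k \<in> A then 1 else -1)"
  by (simp_all add: up_set_path_def)

lemma up_set_path_end:
  assumes "A \<subseteq> {..<T}"
  shows "up_set_path A T = 2 * int (card A) - int T"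
proof -
  have "up_set_path A T = (\<Sum>i<T. 2 * (if i \<in> A then 1 else 0) - 1)"
    unfolding up_set_path_def by (intro sum.cong) auto
  also have "\<dots> = 2 * (\<Sum>i<T. if i \<in> A then 1 else 0) - int T"
    by (simp add: sum_subtractf sum_distrib_left)
  also have "(\<Sum>i<T. if i \<in> A then 1 else 0) = int (card A)"
    using assms by (simp add: sum.If_cases Int_absorb1)
  finally show ?thesis .
qed

lemma is_path_up_set_path:
  assumes "A \<subseteq> {..<T}"
  shows "is_path T (2 * int (card A) - int T) (up_set_path A)"
  using up_set_path_end[OF assms] by (simp add: is_path_def)

text \<open>Membership of \<open>k\<close> can be read off the increment from \<open>k\<close> to
  \<open>Suc k\<close>. Different sets therefore give disjoint histories.\<close>

lemma up_set_path_inj: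
  assumes "A \<subseteq> {..<T}" "B \<subseteq> {..<T}" "\<And>k. k \<le> T \<Longrightarrow> up_set_path A k = up_set_path B k"
  shows "A = B"
proof -
  have "k \<in> A \<longleftrightarrow> k \<in> B" if "k < T" for k
    using assms(3)[of k] assms(3)[of "Suc k"] that by (auto split: if_splits)
  then show ?thesis using assms(1,2) by blast
qed

lemma is_path_obtain_up_set:
  assumes "is_path T M x"
  obtains A where "A \<subseteq> {..<T}" "\<And>k. k \<le> T \<Longrightarrow> x k = up_set_path A k"
proof -
  define A where "A = {k. k < T \<and> x (Suc k) = x k + 1}"
  have "x k = up_set_path A k" if "k \<le> T" for k
    using that
  proof (induction k)
    case 0
    then show ?case using assms by (simp add: is_path_def)
  next
    case (Suc k)
    have "\<bar>x (Suc k) - x k\<bar> = 1" using assms \<open>Suc k \<le> T\<close> unfolding is_path_def by simp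
    then have "x (Suc k) = x k + 1 \<or> x (Suc k) = x k - 1" by linarith
    then show ?case using Suc by (auto simp: A_def)
  qed
  moreover have "A \<subseteq> {..<T}" by (auto simp: A_def)
  ultimately show thesis using that by blast
qed

section \<open>The chain\<close>

context
  fixes N0 :: nat and j :: real and P :: "'a measure" and X :: "nat \<Rightarrow> 'a \<Rightarrow> int"
  assumes chain: "pq_chain N0 j P X"
begin

interpretation prob_space P
  using chain unfolding pq_chain_def by (rule conjunct1)

lemmas pq_chain_measurable =
  chain[unfolded pq_chain_def, THEN conjunct2, THEN conjunct1, rule_format]

lemmas AE_pq_chain_0 =
  chain[unfolded pq_chain_def, THEN conjunct2, THEN conjunct2, THEN conjunct1]

lemmas pq_chain_markov =
  chain[unfolded pq_chain_def, THEN conjunct2, THEN conjunct2, THEN conjunct2, rule_format]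

lemma pq_chain_history_sets:
  assumes "T \<le> N0"
  shows "{\<omega> \<in> space P. \<forall>k\<le>T. X k \<omega> = x k} \<in> sets P"
proof -
  have "{\<omega> \<in> space P. \<forall>k\<in>{..T}. X k \<omega> = x k} \<in> sets P"
  proof (intro sets.sets_Collect_finite_All)
    fix k assume "k \<in> {..T}"
    then show "{\<omega> \<in> space P. X k \<omega> = x k} \<in> sets P"
      using assms pq_chain_measurable[of k] by (auto intro!: measurable_sets_Collect)
  qed simp
  then show ?thesis by (simp only: Ball_def atMost_iff)
qed

text \<open>This is the chain rule for conditional probabilities. Since \<open>x\<close> may also
  make forbidden steps, whose transition probability is 0, it shows such histories to be
  null.\<close>

lemma pq_chain_history:
  assumes "T \<le> N0" "x 0 = 0"
  shows "\<P>(\<omega> in P. \<forall>k\<le>T. X k \<omega> = x k) = path_weight N0 j T x"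
  using assms(1)
proof (induction T)
  case 0
  have "\<P>(\<omega> in P. X 0 \<omega> = 0) = 1"
    using AE_pq_chain_0 pq_chain_history_sets[of 0 "\<lambda>_. 0"]
    by (intro prob_Collect_eq_1[THEN iffD2]) simp_all
  then show ?case using assms(2) by (simp add: path_weight_def)
next
  case (Suc T)
  let ?H = "\<lambda>\<omega>. \<forall>k\<le>T. X k \<omega> = x k"
  have eq: "{\<omega> \<in> space P. \<forall>k\<le>Suc T. X k \<omega> = x k} =
      {\<omega> \<in> space P. X (Suc T) \<omega> = x (Suc T) \<and> ?H \<omega>}"
    by (auto simp: le_Suc_eq)
  have IH: "\<P>(\<omega> in P. ?H \<omega>) = path_weight N0 j T x" using Suc by simp
  show ?case
  \<comment> \<open>The Markov property speaks of histories of positive probability only. If the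
    history is null, its extension is null by monotonicity and the path weight already
    vanishes.\<close>
  proof (cases "\<P>(\<omega> in P. ?H \<omega>) = 0")
    case True
    have "\<P>(\<omega> in P. \<forall>k\<le>Suc T. X k \<omega> = x k) \<le> \<P>(\<omega> in P. ?H \<omega>)"
      using Suc.prems by (intro finite_measure_mono pq_chain_history_sets) auto
    then have "\<P>(\<omega> in P. \<forall>k\<le>Suc T. X k \<omega> = x k) = 0"
      using True measure_nonneg[of P "{\<omega> \<in> space P. \<forall>k\<le>Suc T. X k \<omega> = x k}"] by linarith
    then show ?thesis using True IH by (simp add: path_weight_def)
  next
    case False
    then have "\<P>(\<omega> in P. ?H \<omega>) > 0" by (simp add: zero_less_measure_iff)
    then have "\<P>(\<omega> in P. X (Suc T) \<omega> = x (Suc T) \<bar> ?H \<omega>) = pq_transition N0 j T (x T) (x (Suc T))"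
      using Suc.prems by (intro pq_chain_markov) simp_all
    then have "\<P>(\<omega> in P. X (Suc T) \<omega> = x (Suc T) \<and> ?H \<omega>) =
        path_weight N0 j T x * pq_transition N0 j T (x T) (x (Suc T))"
      using False by (simp add: cond_prob_def field_simps flip: IH)
    then show ?thesis unfolding eq by (simp add: path_weight_def)
  qed
qed

text \<open>Each single history from 0 with a forbidden step is null, and countably many null events
  have a null union.\<close>

lemma AE_pq_chain_is_path:
  assumes "T \<le> N0"
  shows "AE \<omega> in P. is_path T (X T \<omega>) (\<lambda>k. X k \<omega>)"
proof -
  \<comment> \<open>Histories are encoded as lists because there are only countably many of these.\<close>
  have "AE \<omega> in P. (\<forall>k\<le>T. X k \<omega> = xs ! k) \<longrightarrow> is_path T (xs ! T) (\<lambda>k. xs ! k) \<or> xs ! 0 \<noteq> 0"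
    for xs :: "int list"
  proof (cases "is_path T (xs ! T) (\<lambda>k. xs ! k) \<or> xs ! 0 \<noteq> 0")
    case True
    then show ?thesis by simp
  next
    case False
    \<comment> \<open>Here \<open>xs\<close> starts at 0 and its endpoint is \<open>xs ! T\<close>
      by choice, so only the step condition can fail.\<close>
    then obtain k where "k < T" "\<bar>xs ! Suc k - xs ! k\<bar> \<noteq> 1" by (auto simp: is_path_def)
    then have "pq_transition N0 j k (xs ! k) (xs ! Suc k) = 0" "k \<in> {..<T}"
      by (auto simp: pq_transition_def)
    then have "path_weight N0 j T (\<lambda>k. xs ! k) = 0"
      unfolding path_weight_def by (intro prod_zero) auto
    then have "\<P>(\<omega> in P. \<forall>k\<le>T. X k \<omega> = xs ! k) = 0"
      using pq_chain_history[OF assms, of "\<lambda>k. xs ! k"] False by simp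
    then have "AE \<omega> in P. \<not> (\<forall>k\<le>T. X k \<omega> = xs ! k)"
      by (rule prob_Collect_eq_0[OF pq_chain_history_sets[OF assms], THEN iffD1])
    then show ?thesis by (rule eventually_mono) blast
  qed
  then have "AE \<omega> in P. \<forall>xs :: int list. (\<forall>k\<le>T. X k \<omega> = xs ! k) \<longrightarrow>
      is_path T (xs ! T) (\<lambda>k. xs ! k) \<or> xs ! 0 \<noteq> 0"
    unfolding AE_all_countable by (rule allI)
  then show ?thesis
    using AE_pq_chain_0
  proof eventually_elim
    case (elim \<omega>)
    \<comment> \<open>The list has \<open>T + 1\<close> entries, so that \<open>xs ! T\<close> is
      still in range.\<close>
    define xs where "xs = map (\<lambda>k. X k \<omega>) [0..<Suc T]"
    have "xs ! k = X k \<omega>" if "k \<le> T" for k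
      using that unfolding xs_def by (subst nth_map) (auto simp del: upt_Suc)
    then show ?case using elim(1)[rule_format, of xs] elim(2) by (auto simp: is_path_def)
  qed
qed

text \<open>Up to a null set, the event is the disjoint union of the histories given by the
  \<open>k\<close>-element sets of up-steps, all of the same probability.\<close>

lemma pq_chain_distribution:
  assumes "T \<le> N0" "M = 2 * int k - int T"
  shows "\<P>(\<omega> in P. X T \<omega> = M) = real (T choose k) * pq_weight N0 j T M"
proof -
  define \<A> where "\<A> = {A. A \<subseteq> {..<T} \<and> card A = k}"
  define H where "H A = {\<omega> \<in> space P. \<forall>k\<le>T. X k \<omega> = up_set_path A k}" for A
  have H: "H A \<in> events" for A
    unfolding H_def using assms(1) by (rule pq_chain_history_sets)
  have fin: "finite \<A>" by (simp add: \<A>_def)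
  have meas: "{\<omega> \<in> space P. X T \<omega> = M} \<in> events"
    using pq_chain_measurable[OF assms(1)] by (auto intro!: measurable_sets_Collect)
  \<comment> \<open>The two events agree almost everywhere only, because the chain may leave the
    nearest-neighbour paths on a null set.\<close>
  have "AE \<omega> in P. \<omega> \<in> {\<omega> \<in> space P. X T \<omega> = M} \<longleftrightarrow> \<omega> \<in> (\<Union>A\<in>\<A>. H A)"
    using AE_pq_chain_is_path[OF assms(1)] AE_space
  proof eventually_elim
    case (elim \<omega>)
    obtain A where A: "A \<subseteq> {..<T}" "\<And>k. k \<le> T \<Longrightarrow> X k \<omega> = up_set_path A k"
      using is_path_obtain_up_set[OF elim(1)] by blast
    have "card A = k" if "X T \<omega> = M"
      using that A(2)[of T] up_set_path_end[OF A(1)] assms(2) by simp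
    moreover have "X T \<omega> = M" if "\<omega> \<in> H B" "B \<in> \<A>" for B
      using that up_set_path_end[of B T] assms(2) by (simp add: H_def \<A>_def)
    ultimately show ?case using A elim(2) by (auto simp: H_def \<A>_def)
  qed
  then have "\<P>(\<omega> in P. X T \<omega> = M) = prob (\<Union>A\<in>\<A>. H A)"
    using meas H fin by (intro finite_measure_eq_AE) auto
  also have "\<dots> = (\<Sum>A\<in>\<A>. prob (H A))"
  proof (intro finite_measure_finite_Union fin)
    show "disjoint_family_on H \<A>"
      unfolding disjoint_family_on_def
    proof (intro ballI impI)
      fix A B assume "A \<in> \<A>" "B \<in> \<A>" "A \<noteq> B"
      then show "H A \<inter> H B = {}"
        using up_set_path_inj[of A T B] by (auto simp: H_def \<A>_def)
    qed
  qed (use H in auto)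
  also have "\<dots> = (\<Sum>A\<in>\<A>. pq_weight N0 j T M)"
  proof (intro sum.cong refl)
    fix A assume "A \<in> \<A>"
    then have "is_path T M (up_set_path A)"
      using is_path_up_set_path[of A T] assms(2) by (simp add: \<A>_def)
    then show "prob (H A) = pq_weight N0 j T M"
      using assms(1) pq_chain_history[of T "up_set_path A"] by (simp add: H_def path_weight_eq)
  qed
  finally show ?thesis by (simp add: \<A>_def n_subsets)
qed

end

theorem mainTheorem2:
  fixes N0 :: nat and j :: real
  assumes "N0 \<ge> 1" and "j > 0"
  shows "\<exists>(E :: nat \<Rightarrow> int \<Rightarrow> real) (S :: nat \<Rightarrow> int \<Rightarrow> real).
    (\<forall>T\<le>N0. \<forall>M\<in>magnetizations T.
       (\<forall>x. is_path T M x \<longrightarrow> path_weight N0 j T x = exp (- E T M)) \<and>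
       exp (- E T M) =
         (\<Prod>i<nat ((int T - M) div 2). (1 - m_eq N0 j i (- int i)) / 2) *
         (\<Prod>i=1..nat ((int T + M) div 2). (1 + m_eq N0 j (T - i) (M - int i)) / 2) \<and>
       exp (S T M) = real (T choose nat ((M + int T) div 2))) \<and>
    (\<forall>(P :: 'a measure) X. pq_chain N0 j P X \<longrightarrow>
       (\<forall>T\<le>N0. \<forall>M\<in>magnetizations T.
          \<P>(\<omega> in P. X T \<omega> = M) = exp (S T M - E T M)))"
proof -
  \<comment> \<open>Positivity of \<open>pq_weight\<close> makes its logarithm meaningful, so the
    exponential recovers it for all \<open>T\<close> and \<open>M\<close>.\<close>
  define E where "E = (\<lambda>T M. - ln (pq_weight N0 j T M))"
  define S where "S = (\<lambda>T M. ln (real (T choose nat ((M + int T) div 2))))"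
  have E: "exp (- E T M) = pq_weight N0 j T M" for T M
    by (simp add: E_def pq_weight_pos)
  show ?thesis
  proof (rule exI[of _ E], rule exI[of _ S], intro conjI allI ballI impI)
    fix T M assume T: "T \<le> N0" and "M \<in> magnetizations T"
    then obtain k where k: "k \<le> T" "M = 2 * int k - int T" by (auto simp: magnetizations_def)
    \<comment> \<open>\<open>T + M = 2 k\<close> and \<open>T - M = 2 (T - k)\<close> with
      \<open>k \<le> T\<close>, so the divisions are exact and \<open>nat\<close> truncates
      nothing.\<close>
    have k_eq: "nat ((M + int T) div 2) = k" "nat ((int T + M) div 2) = k"
      "nat ((int T - M) div 2) = T - k"
      using k by auto
    \<comment> \<open>The binomial coefficient is positive because \<open>k \<le> T\<close>, so
      \<open>exp\<close> undoes \<open>ln\<close>.\<close>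
    show S: "exp (S T M) = real (T choose nat ((M + int T) div 2))"
      using k(1) by (simp add: S_def k_eq)
    show "path_weight N0 j T x = exp (- E T M)" if "is_path T M x" for x
      using path_weight_eq[OF that T] by (simp add: E)
    show "exp (- E T M) =
        (\<Prod>i<nat ((int T - M) div 2). (1 - m_eq N0 j i (- int i)) / 2) *
        (\<Prod>i=1..nat ((int T + M) div 2). (1 + m_eq N0 j (T - i) (M - int i)) / 2)"
      unfolding E k_eq by (rule pq_weight_down_up[OF T k])
    have "exp (S T M - E T M) = real (T choose k) * pq_weight N0 j T M"
      using S E[of T M] by (simp add: k_eq exp_add flip: add_uminus_conv_diff)
    then show "\<P>(\<omega> in P. X T \<omega> = M) = exp (S T M - E T M)"
      if "pq_chain N0 j P X" for P :: "'a measure" and X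
      using pq_chain_distribution[OF that T k(2)] by simp
  qed
qed

end
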